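(* Let $G$ be a Polish group equipped with a right-invariant metric $d$ (compatible with its topology, $d(xz,yz)=d(x,y)$ for all $x,y,z\in G$). Then every sharply $\mathcal M$-additive set $X\subseteq G$ has sharp measure zero with respect to $d$.
   Context: A Polish group is a topological group whose topology is separable and completely metrizable; the metric $d$ is not assumed complete. For $A,B\subseteq G$, $AB=\{ab:a\in A,b\in B\}$. A set is meager if it is a countable union of nowhere dense sets. A set $X\subseteq G$ is sharply $\mathcal M$-additive if for every meager set $M\subseteq G$ there is a $\sigma$-compact set $K\supseteq X$ such that $MK$ is meager. Sharp measure zero: a sequence $\langle U_n:n\in\omega\rangle$ of sets is a $\gamma$-cover of $X$ if each $x\in X$ belongs to all but finitely many $U_n$; it is a $\gamma$-groupable cover of $X$ if there is a partition $\omega=I_0\cup I_1\cup I_2\cup\dots$ into consecutive finite intervals ($I_{j+1}$ to the right of $I_j$) such that $\langle\bigcup_{n\in I_j}U_n:j\in\omega\rangle$ is a $\gamma$-cover of $X$. A metric space $X$ (or a subset of a metric space, with the restricted metric) has sharp measure zero if for every sequence $\langle\varepsilon_n\rangle$ of positive reals there is a $\gamma$-groupable cover $\langle U_n\rangle$ of $X$ with $\operatorname{diam}U_n\leq\varepsilon_n$ for all $n$. *)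

theory Defs
  imports "HOL-Analysis.Analysis"
begin

text \<open>
  Groups are written additively, following the type classes \<^class>\<open>group_add\<close> and
  \<^class>\<open>topological_group_add\<close>; neither class assumes commutativity. The product \<open>AB\<close> of two
  sets is therefore the elementwise sum \<open>A + B\<close>, in this order.
\<close>

definition nowhere_dense :: "'a::topological_space set \<Rightarrow> bool"
  where "nowhere_dense A \<longleftrightarrow> interior (closure A) = {}"

definition meager :: "'a::topological_space set \<Rightarrow> bool"
  where "meager M \<longleftrightarrow> (\<exists>\<N>. countable \<N> \<and> (\<forall>N\<in>\<N>. nowhere_dense N) \<and> M = \<Union>\<N>)"

definition sigma_compact :: "'a::topological_space set \<Rightarrow> bool"
  where "sigma_compact K \<longleftrightarrow> (\<exists>\<C>. countable \<C> \<and> (\<forall>C\<in>\<C>. compact C) \<and> K = \<Union>\<C>)"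

definition sharply_meager_additive :: "'a::topological_group_add set \<Rightarrow> bool"
  where "sharply_meager_additive X \<longleftrightarrow>
    (\<forall>M. meager M \<longrightarrow> (\<exists>K. sigma_compact K \<and> X \<subseteq> K \<and> meager (M + K)))"

definition gamma_cover :: "(nat \<Rightarrow> 'a set) \<Rightarrow> 'a set \<Rightarrow> bool"
  where "gamma_cover U X \<longleftrightarrow> (\<forall>x\<in>X. finite {n. x \<notin> U n})"

text \<open>Partitions of the natural numbers into consecutive, nonempty, finite intervals
  \<open>I 0, I 1, \<dots>\<close>, presented by their left endpoints \<open>k 0 = 0 < k 1 < k 2 < \<dots>\<close>.\<close>

definition interval_partition :: "(nat \<Rightarrow> nat set) \<Rightarrow> bool"
  where "interval_partition I \<longleftrightarrow>
    (\<exists>k::nat \<Rightarrow> nat. k 0 = 0 \<and> strict_mono k \<and> (\<forall>j. I j = {k j..<k (Suc j)}))"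

definition gamma_groupable_cover :: "(nat \<Rightarrow> 'a set) \<Rightarrow> 'a set \<Rightarrow> bool"
  where "gamma_groupable_cover U X \<longleftrightarrow>
    (\<exists>I. interval_partition I \<and> gamma_cover (\<lambda>j. \<Union>n\<in>I j. U n) X)"

text \<open>The covering sets are subsets of the metric subspace \<open>X\<close>. Boundedness is required
  explicitly because the real-valued \<^const>\<open>diameter\<close> of an unbounded set is an unspecified
  supremum rather than infinity.\<close>

definition sharp_measure_zero :: "'a::metric_space set \<Rightarrow> bool"
  where "sharp_measure_zero X \<longleftrightarrow>
    (\<forall>\<epsilon>::nat \<Rightarrow> real. (\<forall>n. 0 < \<epsilon> n) \<longrightarrow>
      (\<exists>U. gamma_groupable_cover U X \<and>
           (\<forall>n. U n \<subseteq> X \<and> bounded (U n) \<and> diameter (U n) \<le> \<epsilon> n)))"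

end

theory Submission
  imports Defs
begin

text \<open>
  The proof is a Galvin--Mycielski--Solovay argument. Fix \<open>\<epsilon>\<close> and a sequence \<open>q\<close> that visits every
  nonempty open set infinitely often. The points \<open>z\<close> for which \<open>-z\<close> lies in infinitely many of the
  balls \<open>ball (q n) (\<epsilon> n / 2)\<close> form a dense \<open>G\<^sub>\<delta>\<close> set, so its complement \<open>M\<close> is meager
  (\<open>meager_finitely_often\<close>). Sharp additivity provides a \<open>\<sigma>\<close>-compact \<open>K \<supseteq> X\<close> with \<open>M + K\<close> meager,
  and the Baire category theorem a point \<open>y \<notin> M + K\<close> (\<open>meager_neq_UNIV\<close>). For \<open>k \<in> K\<close> the point
  \<open>y - k\<close> is outside \<open>M\<close>, so \<open>k - y\<close> lies in infinitely many of the balls; by right invariance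
  \<open>k\<close> lies in infinitely many of their translates \<open>ball (q n + y) (\<epsilon> n / 2)\<close>, which have diameter
  at most \<open>\<epsilon> n\<close>.

  This only says that each point of \<open>K\<close> is covered infinitely often, which is the kind of cover that
  strong measure zero gives. The \<open>\<sigma>\<close>-compactness of \<open>K\<close> improves it: every tail of the
  sequence of balls covers \<open>K\<close>, so finitely many balls of that tail cover a given compact piece,
  and the balls can be grouped into consecutive finite blocks that cover larger and larger
  compact pieces (\<open>gamma_groupable_cover_of_sigma_compact\<close>).
\<close>

lemma meager_neq_UNIV:
  fixes M :: "'a::topological_space set"
  assumes "completely_metrizable_space (euclidean :: 'a topology)" and "meager M"
  shows "M \<noteq> UNIV"
proof -
  obtain \<N> where \<N>: "countable \<N>" "\<And>N. N \<in> \<N> \<Longrightarrow> interior (closure N) = {}" "M = \<Union>\<N>"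
    using assms(2) by (auto simp: meager_def nowhere_dense_def)
  have "euclidean interior_of \<Union>(closure ` \<N>) = {}"
  proof (rule Baire_category_alt)
    show "completely_metrizable_space (euclidean :: 'a topology)
        \<or> locally_compact_space (euclidean :: 'a topology) \<and> regular_space (euclidean :: 'a topology)"
      using assms(1) by blast
  qed (use \<N> in auto)
  then have "interior (\<Union>(closure ` \<N>)) = {}" by simp
  moreover have "M \<subseteq> \<Union>(closure ` \<N>)"
    using \<N>(3) closure_subset by blast
  ultimately have "interior M = {}"
    using interior_mono by blast
  then show ?thesis by auto
qed

lemma meager_finitely_often:
  fixes W :: "nat \<Rightarrow> 'a::topological_space set"
  assumes "\<And>n. open (W n)"
    and dense: "\<And>V m. open V \<Longrightarrow> V \<noteq> {} \<Longrightarrow> \<exists>n\<ge>m. W n \<inter> V \<noteq> {}"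
  shows "meager {z. finite {n. z \<in> W n}}"
proof -
  let ?N = "\<lambda>m. - (\<Union>n\<in>{m..}. W n)"
  have closed: "closed (?N m)" for m
    using assms(1) by (intro closed_Compl open_UN) auto
  have "nowhere_dense (?N m)" for m
  proof -
    have "interior (?N m) = {}"
    proof (rule ccontr)
      assume "interior (?N m) \<noteq> {}"
      then obtain n where "n \<ge> m" "W n \<inter> interior (?N m) \<noteq> {}"
        using dense[OF open_interior] by blast
      then show False
        using interior_subset by fastforce
    qed
    then show ?thesis
      using closed by (simp add: nowhere_dense_def closure_closed)
  qed
  moreover have "{z. finite {n. z \<in> W n}} = \<Union>(range ?N)"
  proof -
    have "finite {n. z \<in> W n} \<longleftrightarrow> (\<exists>m. \<forall>n\<ge>m. z \<notin> W n)" for z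
        unfolding finite_nat_set_iff_bounded by (simp add: Ball_def) (meson not_less)
    then show ?thesis by auto
  qed
  ultimately show ?thesis
    unfolding meager_def by (intro exI[of _ "range ?N"]) auto
qed

text \<open>Enumerating a countable dense set with infinite repetition makes every tail dense, also at
  isolated points.\<close>

lemma separable_imp_sequence_visiting_open_sets:
  assumes "separable_space (euclidean :: 'a::topological_space topology)"
  obtains q :: "nat \<Rightarrow> 'a::topological_space" where "\<And>V m. open V \<Longrightarrow> V \<noteq> {} \<Longrightarrow> \<exists>n\<ge>m. q n \<in> V"
proof -
  obtain S :: "'a set" where S: "countable S" "closure S = UNIV"
    using assms by (auto simp: separable_space_def)
  define q where "q n = from_nat_into S (fst (prod_decode n))" for n
  have "\<exists>n\<ge>m. q n \<in> V" if V: "open V" "V \<noteq> {}" for V m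
  proof -
    obtain s where "s \<in> V" "s \<in> S"
      using V S(2) open_Int_closure_eq_empty[of V S] by auto
    then obtain i where "from_nat_into S i = s"
      using from_nat_into_surj[OF S(1)] by blast
    then have "q (prod_encode (i, m)) \<in> V"
      using \<open>s \<in> V\<close> by (simp add: q_def)
    then show ?thesis
      using le_prod_encode_2 by blast
  qed
  then show ?thesis using that by blast
qed

text \<open>Infinitely often already means that each tail of \<open>W\<close> is a cover; compactness then bounds how
  much of a tail is needed, uniformly over each compact piece of \<open>K\<close>. This yields the blocks.\<close>

lemma gamma_groupable_cover_of_sigma_compact:
  fixes W :: "nat \<Rightarrow> 'a::topological_space set"
  assumes "sigma_compact K" and "\<And>n. open (W n)"
    and inf: "\<And>x. x \<in> K \<Longrightarrow> infinite {n. x \<in> W n}"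
  shows "gamma_groupable_cover W K"
proof -
  obtain \<C> where \<C>: "countable \<C>" "\<And>C. C \<in> \<C> \<Longrightarrow> compact C" "K = \<Union>\<C>"
    using assms(1) by (auto simp: sigma_compact_def)
  \<comment> \<open>The empty set is added so that the family can be enumerated even if it is empty.\<close>
  define c where "c = from_nat_into (insert {} \<C>)"
  have range_c: "range c = insert {} \<C>"
    unfolding c_def using \<C>(1) by (intro range_from_nat_into) auto
  define L where "L j = (\<Union>i\<le>j. c i)" for j
  have "compact (c i)" for i
    using range_c \<C>(2) rangeI[of c i] by auto
  then have compact_L: "compact (L j)" for j
    unfolding L_def by (intro compact_UN) auto
  have K_eq: "K = (\<Union>j. L j)"
  proof -
    have "K = \<Union>(range c)" using range_c \<C>(3) by simp
    then show ?thesis unfolding L_def by blast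
  qed
  have "\<exists>m'>m. L j \<subseteq> (\<Union>n\<in>{m..<m'}. W n)" for m j
  proof -
    have "L j \<subseteq> (\<Union>n\<in>{m..}. W n)"
    proof
      fix x assume "x \<in> L j"
      then have "infinite {n. x \<in> W n}" using inf K_eq by blast
      then show "x \<in> (\<Union>n\<in>{m..}. W n)"
        unfolding infinite_nat_iff_unbounded_le by auto
    qed
    then obtain F where F: "F \<subseteq> {m..}" "finite F" "L j \<subseteq> (\<Union>n\<in>F. W n)"
      by (rule compactE_image[OF compact_L assms(2)])
    have "F \<subseteq> {m..<Suc (Max (insert m F))}"
      using F by (auto simp: less_Suc_eq_le)
    moreover have "m < Suc (Max (insert m F))"
      using F(2) by (simp add: less_Suc_eq_le)
    ultimately show ?thesis
      using F(3) by blast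
  qed
  then obtain next_end where next_end:
    "\<And>m j. next_end m j > m" "\<And>m j. L j \<subseteq> (\<Union>n\<in>{m..<next_end m j}. W n)"
    by metis
  define k where "k = rec_nat 0 (\<lambda>j m. next_end m j)"
  have k_0: "k 0 = 0" and k_Suc: "k (Suc j) = next_end (k j) j" for j
    by (simp_all add: k_def)
  have "strict_mono k"
    using next_end(1) by (simp add: strict_mono_Suc_iff k_Suc)
  then have partition: "interval_partition (\<lambda>j. {k j..<k (Suc j)})"
    using k_0 unfolding interval_partition_def by blast
  have "gamma_cover (\<lambda>j. \<Union>n\<in>{k j..<k (Suc j)}. W n) K"
    unfolding gamma_cover_def
  proof
    fix x assume "x \<in> K"
    then obtain i where "x \<in> L i" using K_eq by blast
    then have "x \<in> L j" if "i \<le> j" for j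
      using that unfolding L_def by fastforce
    then have "x \<in> (\<Union>n\<in>{k j..<k (Suc j)}. W n)" if "i \<le> j" for j
      using that next_end(2)[of j "k j"] unfolding k_Suc by blast
    then have "{j. x \<notin> (\<Union>n\<in>{k j..<k (Suc j)}. W n)} \<subseteq> {..<i}"
      using not_le by blast
    then show "finite {j. x \<notin> (\<Union>n\<in>{k j..<k (Suc j)}. W n)}"
      using finite_subset by blast
  qed
  then show ?thesis
    using partition unfolding gamma_groupable_cover_def by blast
qed

lemma gamma_groupable_cover_Int:
  assumes "gamma_groupable_cover W K" and "X \<subseteq> K"
  shows "gamma_groupable_cover (\<lambda>n. W n \<inter> X) X"
proof -
  obtain I where "interval_partition I" and cover: "gamma_cover (\<lambda>j. \<Union>n\<in>I j. W n) K"
    using assms(1) unfolding gamma_groupable_cover_def by blast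
  moreover have "gamma_cover (\<lambda>j. \<Union>n\<in>I j. W n \<inter> X) X"
    unfolding gamma_cover_def
  proof
    fix x assume "x \<in> X"
    then have "{j. x \<notin> (\<Union>n\<in>I j. W n \<inter> X)} = {j. x \<notin> (\<Union>n\<in>I j. W n)}" by blast
    then show "finite {j. x \<notin> (\<Union>n\<in>I j. W n \<inter> X)}"
      using cover \<open>x \<in> X\<close> assms(2) unfolding gamma_cover_def by auto
  qed
  ultimately show ?thesis
    unfolding gamma_groupable_cover_def by blast
qed

theorem theorem1p1:
  fixes X :: "'g::{topological_group_add, metric_space} set"
  assumes "separable_space (euclidean :: 'g topology)"
    and "completely_metrizable_space (euclidean :: 'g topology)"
    and "\<And>x y z :: 'g. dist (x + z) (y + z) = dist x y"
    and "sharply_meager_additive X"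
  shows "sharp_measure_zero X"
  unfolding sharp_measure_zero_def
proof (intro allI impI)
  fix \<epsilon> :: "nat \<Rightarrow> real"
  assume \<epsilon>: "\<forall>n. 0 < \<epsilon> n"
  obtain q :: "nat \<Rightarrow> 'g" where q: "\<And>V m. open V \<Longrightarrow> V \<noteq> {} \<Longrightarrow> \<exists>n\<ge>m. q n \<in> V"
    using separable_imp_sequence_visiting_open_sets[OF assms(1)] by blast
  let ?W = "\<lambda>n. uminus -` ball (q n) (\<epsilon> n / 2)"
  have open_vimage_uminus: "open (uminus -` V)" if "open V" for V :: "'g set"
    using that by (intro open_vimage) (auto simp: continuous_on_def intro: tendsto_minus)
  have "meager {z. finite {n. z \<in> ?W n}}" (is "meager ?M")
  proof (rule meager_finitely_often)
    show "open (?W n)" for n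
      by (intro open_vimage_uminus open_ball)
    fix V :: "'g set" and m
    assume "open V" "V \<noteq> {}"
    moreover have "uminus -` V \<noteq> {}"
      using \<open>V \<noteq> {}\<close> by (metis ex_in_conv minus_minus vimageI2)
    ultimately obtain n where "n \<ge> m" "- q n \<in> V"
      using q[of "uminus -` V" m] open_vimage_uminus by auto
    moreover have "- q n \<in> ?W n"
      using \<epsilon> by simp
    ultimately show "\<exists>n\<ge>m. ?W n \<inter> V \<noteq> {}"
      by blast
  qed
  then obtain K where K: "sigma_compact K" "X \<subseteq> K" "meager (?M + K)"
    using assms(4) unfolding sharply_meager_additive_def by blast
  obtain y where y: "y \<notin> ?M + K"
    using meager_neq_UNIV[OF assms(2) K(3)] by blast
  let ?B = "\<lambda>n. ball (q n + y) (\<epsilon> n / 2)"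
  have "infinite {n. x \<in> ?B n}" if "x \<in> K" for x
  proof -
    have "y - x \<notin> ?M"
      using y that set_plus_intro[of "y - x" ?M x K] by auto
    moreover have "y - x \<in> ?W n \<longleftrightarrow> x \<in> ?B n" for n
      using assms(3)[of "q n" y "x - y"] by simp
    ultimately show ?thesis by simp
  qed
  then have "gamma_groupable_cover ?B K"
    using K(1) by (intro gamma_groupable_cover_of_sigma_compact) auto
  then have "gamma_groupable_cover (\<lambda>n. ?B n \<inter> X) X"
    using K(2) by (rule gamma_groupable_cover_Int)
  moreover have "diameter (?B n \<inter> X) \<le> \<epsilon> n" for n
  proof -
    have "dist u v \<le> \<epsilon> n" if "u \<in> ?B n \<inter> X" "v \<in> ?B n \<inter> X" for u v
      using that dist_triangle3[of u v "q n + y"] by simp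
    then show ?thesis
      unfolding diameter_def using \<epsilon> by (auto intro!: cSUP_least simp: less_imp_le)
  qed
  ultimately show "\<exists>U. gamma_groupable_cover U X \<and>
      (\<forall>n. U n \<subseteq> X \<and> bounded (U n) \<and> diameter (U n) \<le> \<epsilon> n)"
    by (intro exI[of _ "\<lambda>n. ?B n \<inter> X"]) auto
qed

end
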